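(* Let $\Omega$ be an open connected subset of $\mathbb{R}^d$ and let $\{f_j\}_{j\geq 1}$ be a set of real-valued functions defined on $\Omega$ such that: (i) each $f_j$ is real analytic up to a set $I_j\subset\Omega$ of null Lebesgue measure, i.e. $f_j$ is real analytic on $\Omega\setminus I_j$; (ii) for every $m\geq 1$, the functions $\{f_j\}_{j\geq 1}$ are linearly independent on every connected component of $\Omega\setminus I^{(m)}$, where $I^{(m)}=\bigcup_{j=1}^m I_j$. Moreover, let $\{x_i\}_{i\geq 1}$ be a randomly distributed sequence on $\Omega$ with respect to any given probability density $\sigma(x)$, i.e. a point sequence produced by sampling a sequence of continuous random variables $\{X_i\}_{i\geq 1}$ which are independent and identically distributed in $\Omega$ with density $\sigma(x)$. Then, for every $m\geq 1$, the matrix $V_m=[f_j(x_i)]_{1\leq i,j\leq m}$ is almost surely nonsingular (that is, $\det [f_j(X_i)]_{1\leq i,j\leq m}\neq 0$ with probability $1$).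
   Context: A function is real analytic on an open subset $U\subset\mathbb{R}^d$ if for each $x\in U$ the function may be represented by a convergent power series in some neighborhood of $x$. In saying that $f_j$ is real analytic on $\Omega\setminus I_j$ it is understood that $\Omega\setminus I_j$ is open, i.e. $I_j$ is closed in the induced topology of $\Omega$. Densities are with respect to Lebesgue measure on $\Omega$. Functions are linearly independent on a set if every finite linear combination of them that vanishes identically on that set has all coefficients zero. *)

theory Defs
  imports "HOL-Probability.Probability" "Jordan_Normal_Form.Determinant"
begin

no_notation vec_index (infixl \<open>$\<close> 100)

text \<open>
  Real analyticity on an open set: near each point the function is the sum of a convergent power
  series in several variables. The series is indexed by multi-indices \<open>\<alpha> :: 'n \<Rightarrow> nat\<close>; as these carry
  no canonical order, convergence is unconditional (equivalently, absolute), as expressed by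
  \<^const>\<open>has_sum\<close>. Openness of the domain is part of the notion.
\<close>

definition real_analytic_on :: "(real ^ 'n \<Rightarrow> real) \<Rightarrow> (real ^ 'n) set \<Rightarrow> bool"
    (infixl \<open>real'_analytic'_on\<close> 50) where
  "f real_analytic_on U \<longleftrightarrow> open U \<and>
     (\<forall>x\<in>U. \<exists>r>0. \<exists>a :: ('n \<Rightarrow> nat) \<Rightarrow> real. ball x r \<subseteq> U \<and>
        (\<forall>y\<in>ball x r.
           ((\<lambda>\<alpha>. a \<alpha> * (\<Prod>i\<in>UNIV. (y $ i - x $ i) ^ \<alpha> i)) has_sum f y) UNIV))"

text \<open>
  Linear independence on \<open>S\<close> of the family \<open>f j\<close>, \<open>j \<in> J\<close> (so repeated members count as dependent);
  only the values of the functions on \<open>S\<close> matter.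
\<close>

definition lin_indep_family_on :: "'i set \<Rightarrow> ('i \<Rightarrow> 'a \<Rightarrow> real) \<Rightarrow> 'a set \<Rightarrow> bool" where
  "lin_indep_family_on J f S \<longleftrightarrow>
     (\<forall>F c. finite F \<and> F \<subseteq> J \<and> (\<forall>x\<in>S. (\<Sum>j\<in>F. c j * f j x) = 0) \<longrightarrow> (\<forall>j\<in>F. c j = 0))"

text \<open>
  The matrix with entries \<open>f\<^sub>j (x\<^sub>i)\<close>, \<open>1 \<le> i, j \<le> m\<close>; the shift is due to the entries of
  \<^type>\<open>mat\<close> being numbered from \<open>0\<close>.
\<close>

definition sampling_matrix :: "(nat \<Rightarrow> 'a \<Rightarrow> real) \<Rightarrow> (nat \<Rightarrow> 'a) \<Rightarrow> nat \<Rightarrow> real mat" where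
  "sampling_matrix f x m = mat m m (\<lambda>(i, j). f (Suc j) (x (Suc i)))"

end

theory Submission
  imports Defs "HOL-Complex_Analysis.Conformal_Mappings"
begin

text \<open>
  Expanding \<open>det V\<^sub>k\<^sub>+\<^sub>1\<close> along its last row shows that, for fixed \<open>x\<^sub>1, \<dots>, x\<^sub>k\<close> with \<open>det V\<^sub>k \<noteq> 0\<close>,
  it is a linear combination of \<open>f\<^sub>1, \<dots>, f\<^sub>k\<^sub>+\<^sub>1\<close> evaluated at \<open>x\<^sub>k\<^sub>+\<^sub>1\<close> in which \<open>f\<^sub>k\<^sub>+\<^sub>1\<close> has coefficient
  \<open>det V\<^sub>k\<close>. By linear independence this combination vanishes identically on no component of
  \<open>\<Omega> - (I\<^sub>1 \<union> \<dots> \<union> I\<^sub>m)\<close>, so its zero set is Lebesgue null, and induction on \<open>k\<close> with Fubini's theorem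
  concludes.

  That the zeros of a real analytic function form a null set needs no induction on the dimension:
  around a point \<open>p\<close> of non-vanishing, the restriction to every line through \<open>p\<close> extends to a
  holomorphic function of one variable, so every such line contains only countably many zeros.
\<close>

unbundle no fps_syntax

section \<open>Power series in several variables: majorants, continuity, restriction to
  lines\<close>

text \<open>Unconditional convergence of a real series is absolute; it is used at the point
  \<open>x + \<rho>\<close>, where the monomials are nonnegative. This supplies the majorant for the
  Weierstrass M-tests, real and complex.\<close>

lemma multi_power_series_abs_summable:
  fixes x \<rho> :: "real ^ 'n"
  assumes series: "\<And>y. y \<in> ball x r \<Longrightarrow>
      ((\<lambda>\<alpha>. a \<alpha> * (\<Prod>i\<in>UNIV. (y $ i - x $ i) ^ \<alpha> i)) has_sum f y) UNIV"
    and "norm \<rho> < r" and "\<And>i. 0 \<le> \<rho> $ i"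
  shows "(\<lambda>\<alpha>. \<bar>a \<alpha>\<bar> * (\<Prod>i\<in>UNIV. \<rho> $ i ^ \<alpha> i)) summable_on UNIV"
proof -
  have "x + \<rho> \<in> ball x r"
    using assms(2) by (simp add: dist_norm)
  from series[OF this] have "(\<lambda>\<alpha>. a \<alpha> * (\<Prod>i\<in>UNIV. \<rho> $ i ^ \<alpha> i)) summable_on UNIV"
    by (auto simp: summable_on_def)
  then have "(\<lambda>\<alpha>. norm (a \<alpha> * (\<Prod>i\<in>UNIV. \<rho> $ i ^ \<alpha> i))) summable_on UNIV"
    by (rule summable_on_iff_abs_summable_on_real[THEN iffD1])
  moreover have "norm (a \<alpha> * (\<Prod>i\<in>UNIV. \<rho> $ i ^ \<alpha> i)) = \<bar>a \<alpha>\<bar> * (\<Prod>i\<in>UNIV. \<rho> $ i ^ \<alpha> i)" for \<alpha>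
    using assms(3) by (simp add: abs_mult abs_prod)
  ultimately show ?thesis
    by simp
qed

lemma real_analytic_on_imp_continuous_on:
  assumes "f real_analytic_on U"
  shows "continuous_on U f"
proof -
  have "isCont f x" if x: "x \<in> U" for x
  proof -
    obtain r a where "r > 0" and series: "\<And>y. y \<in> ball x r \<Longrightarrow>
        ((\<lambda>\<alpha>. a \<alpha> * (\<Prod>i\<in>UNIV. (y $ i - x $ i) ^ \<alpha> i)) has_sum f y) UNIV"
      using assms x unfolding real_analytic_on_def by blast
    \<comment> \<open>Here \<open>1\<close> is the all-ones vector. The vector with all coordinates
      \<open>\<delta>\<close> has norm below \<open>r\<close>, and its monomials dominate those of
      \<open>y - x\<close> for every \<open>y\<close> in \<open>cball x \<delta>\<close>.\<close>
    define \<delta> where "\<delta> = r / (norm (1 :: real ^ 'a) + 1)"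
    have \<delta>: "\<delta> > 0" "\<delta> * norm (1 :: real ^ 'a) < r"
      using \<open>r > 0\<close> norm_ge_zero[of "1 :: real ^ 'a"]
      by (auto simp: \<delta>_def field_simps add_nonneg_pos)
    have "\<delta> * norm (1 :: real ^ 'a) \<ge> \<delta>"
      using \<delta>(1) component_le_norm_cart[of "1 :: real ^ 'a" undefined] by simp
    then have sub: "cball x \<delta> \<subseteq> ball x r"
      using \<delta>(2) by auto
    have "uniform_limit (cball x \<delta>)
        (\<lambda>A y. \<Sum>\<alpha>\<in>A. a \<alpha> * (\<Prod>i\<in>UNIV. (y $ i - x $ i) ^ \<alpha> i)) f (finite_subsets_at_top UNIV)"
    proof (rule Weierstrass_m_test_general')
      have "(\<lambda>\<alpha>. \<bar>a \<alpha>\<bar> * (\<Prod>i\<in>UNIV. (\<delta> *\<^sub>R (1 :: real ^ 'a)) $ i ^ \<alpha> i)) summable_on UNIV"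
        using \<delta> by (intro multi_power_series_abs_summable[OF series]) auto
      then show "(\<lambda>\<alpha>. \<bar>a \<alpha>\<bar> * (\<Prod>i\<in>UNIV. \<delta> ^ \<alpha> i)) summable_on UNIV"
        by simp
      show "((\<lambda>\<alpha>. a \<alpha> * (\<Prod>i\<in>UNIV. (y $ i - x $ i) ^ \<alpha> i)) has_sum f y) UNIV"
        if "y \<in> cball x \<delta>" for y
        using that sub by (intro series) auto
      show "norm (a \<alpha> * (\<Prod>i\<in>UNIV. (y $ i - x $ i) ^ \<alpha> i)) \<le> \<bar>a \<alpha>\<bar> * (\<Prod>i\<in>UNIV. \<delta> ^ \<alpha> i)"
        if "y \<in> cball x \<delta>" for \<alpha> y
      proof -
        have "\<bar>y $ i - x $ i\<bar> \<le> \<delta>" for i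
          using component_le_norm_cart[of "y - x" i] that
          by (simp add: dist_norm norm_minus_commute)
        then show ?thesis
          by (auto simp: abs_mult abs_prod power_abs intro!: mult_left_mono prod_mono power_mono)
      qed
    qed
    then have "continuous_on (cball x \<delta>) f"
      by (rule uniform_limit_theorem[rotated])
         (auto intro!: always_eventually continuous_intros)
    then show ?thesis
      using \<delta>(1) by (intro continuous_on_interior[of "cball x \<delta>"]) auto
  qed
  then show ?thesis
    by (simp add: continuous_at_imp_continuous_on)
qed

text \<open>The parameter \<open>t\<close> of the line is allowed to be complex in the series.
  Convergence depends only on the moduli of the coordinates, so it holds wherever the complex vector
  \<open>W t\<close> has norm below \<open>r\<close>. As \<open>W\<close> is affine, this domain
  \<open>D\<close> is open and convex, hence connected, as the identity theorem requires.\<close>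

lemma multi_power_series_along_line:
  fixes x p v :: "real ^ 'n"
  assumes series: "\<And>y. y \<in> ball x r \<Longrightarrow>
      ((\<lambda>\<alpha>. a \<alpha> * (\<Prod>i\<in>UNIV. (y $ i - x $ i) ^ \<alpha> i)) has_sum f y) UNIV"
  obtains D G where "open D" "convex D" "G holomorphic_on D"
    "\<And>t. p + t *\<^sub>R v \<in> ball x r \<Longrightarrow> of_real t \<in> D"
    "\<And>t. p + t *\<^sub>R v \<in> ball x r \<Longrightarrow> G (of_real t) = complex_of_real (f (p + t *\<^sub>R v))"
proof -
  define w where "w t i = complex_of_real (p $ i - x $ i) + t * of_real (v $ i)" for t i
  define W :: "complex \<Rightarrow> complex ^ 'n" where "W t = (\<chi> i. w t i)" for t
  define D where "D = {t. norm (W t) < r}"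
  define G where "G t = (\<Sum>\<^sub>\<infinity>\<alpha>. complex_of_real (a \<alpha>) * (\<Prod>i\<in>UNIV. w t i ^ \<alpha> i))" for t
  have cont: "continuous_on UNIV W"
    unfolding W_def w_def by (intro continuous_intros)
  have "open D"
    unfolding D_def using cont by (intro open_Collect_less continuous_intros)
  moreover have "convex D"
  proof (rule convexI)
    fix s t :: complex and u k :: real
    assume st: "s \<in> D" "t \<in> D" and uk: "0 \<le> u" "0 \<le> k" "u + k = 1"
    have k: "k = 1 - u" using uk by simp
    have "w (u *\<^sub>R s + k *\<^sub>R t) i = u *\<^sub>R w s i + k *\<^sub>R w t i" for i
      unfolding k by (simp add: w_def algebra_simps scaleR_conv_of_real)
    then have "W (u *\<^sub>R s + k *\<^sub>R t) = u *\<^sub>R W s + k *\<^sub>R W t"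
      by (simp add: Finite_Cartesian_Product.vec_eq_iff W_def)
    moreover have "u *\<^sub>R W s + k *\<^sub>R W t \<in> ball 0 r"
      using st uk by (intro convexD[OF convex_ball]) (auto simp: D_def)
    ultimately show "u *\<^sub>R s + k *\<^sub>R t \<in> D"
      by (simp add: D_def)
  qed
  moreover have "G holomorphic_on D"
  proof -
    have "G field_differentiable (at t)" if "t \<in> D" for t
    proof -
      \<comment> \<open>On \<open>cball t e\<close> the \<open>i\<close>-th coordinate has modulus
        at most \<open>cmod (w t i) + e * \<bar>v $ i\<bar>\<close>. The radius is chosen so that
        the vector \<open>\<rho>\<close> of these bounds still has norm below \<open>r\<close>; the
        \<open>+ 1\<close> makes this strict and covers \<open>v = 0\<close>.\<close>
      define e where "e = (r - norm (W t)) / (norm v + 1)"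
      have e: "e > 0"
        using that by (auto simp: e_def D_def intro!: divide_pos_pos add_nonneg_pos)
      define \<rho> :: "real ^ 'n" where "\<rho> = (\<chi> i. cmod (w t i)) + e *\<^sub>R (\<chi> i. \<bar>v $ i\<bar>)"
      have abs_v: "norm (\<chi> i. \<bar>v $ i\<bar>) = norm v"
        by (simp add: norm_vec_def)
      have norm_W: "norm (\<chi> i. cmod (w t i)) = norm (W t)"
        by (simp add: norm_vec_def W_def)
      have "norm \<rho> \<le> norm (\<chi> i. cmod (w t i)) + norm (e *\<^sub>R (\<chi> i. \<bar>v $ i\<bar>))"
        unfolding \<rho>_def by (rule norm_triangle_ineq)
      also have "\<dots> = norm (W t) + e * norm v"
        using e abs_v norm_W by simp
      also have "\<dots> < norm (W t) + e * (norm v + 1)"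
        using e by simp
      also have "\<dots> = r"
        unfolding e_def using norm_ge_zero[of v] by (simp add: add_nonneg_eq_0_iff)
      finally have "norm \<rho> < r" .
      have bound: "cmod (w z i) \<le> \<rho> $ i" if "z \<in> cball t e" for z i
      proof -
        have "w z i = w t i + (z - t) * of_real (v $ i)"
          by (simp add: w_def algebra_simps)
        then have "cmod (w z i) \<le> cmod (w t i) + cmod (z - t) * \<bar>v $ i\<bar>"
          by (metis norm_mult norm_of_real norm_triangle_ineq)
        also have "\<dots> \<le> cmod (w t i) + e * \<bar>v $ i\<bar>"
          using that by (intro add_left_mono mult_right_mono) (auto simp: dist_norm norm_minus_commute)
        finally show ?thesis
          by (simp add: \<rho>_def)
      qed
      have "uniform_limit (cball t e)
          (\<lambda>A z. \<Sum>\<alpha>\<in>A. complex_of_real (a \<alpha>) * (\<Prod>i\<in>UNIV. w z i ^ \<alpha> i)) G (finite_subsets_at_top UNIV)"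
        unfolding G_def
      proof (rule Weierstrass_m_test_general)
        show "(\<lambda>\<alpha>. \<bar>a \<alpha>\<bar> * (\<Prod>i\<in>UNIV. \<rho> $ i ^ \<alpha> i)) summable_on UNIV"
          using e by (intro multi_power_series_abs_summable[OF series \<open>norm \<rho> < r\<close>]) (auto simp: \<rho>_def)
        fix \<alpha> z assume "z \<in> cball t e"
        then show "cmod (complex_of_real (a \<alpha>) * (\<Prod>i\<in>UNIV. w z i ^ \<alpha> i))
            \<le> \<bar>a \<alpha>\<bar> * (\<Prod>i\<in>UNIV. \<rho> $ i ^ \<alpha> i)"
          by (auto simp: norm_mult prod_norm[symmetric] norm_power
              intro!: mult_left_mono prod_mono power_mono bound)
      qed
      \<comment> \<open>The partial sums are polynomials in the complex parameter, so their uniform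
        limit is holomorphic.\<close>
      then have "G holomorphic_on ball t e"
        by (rule holomorphic_uniform_limit[rotated])
           (auto simp: w_def intro!: always_eventually continuous_intros holomorphic_intros)
      then show ?thesis
        using e by (simp add: holomorphic_on_imp_differentiable_at)
    qed
    then show ?thesis
      by (simp add: holomorphic_on_def field_differentiable_at_within)
  qed
  moreover have "of_real t \<in> D" if "p + t *\<^sub>R v \<in> ball x r" for t
  proof -
    have "w (of_real t) i = of_real ((p + t *\<^sub>R v - x) $ i)" for i
      by (simp add: w_def algebra_simps)
    then have "norm (W (of_real t)) = norm (p + t *\<^sub>R v - x)"
      by (simp add: norm_vec_def W_def del: vector_minus_component vector_add_component)
    then show ?thesis
      using that by (simp add: D_def dist_norm norm_minus_commute)
  qed
  moreover have "G (of_real t) = complex_of_real (f (p + t *\<^sub>R v))" if "p + t *\<^sub>R v \<in> ball x r" for t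
  proof -
    have "w (of_real t) i = of_real ((p + t *\<^sub>R v) $ i - x $ i)" for i
      by (simp add: w_def algebra_simps)
    then show ?thesis
      using has_sum_of_real[OF series[OF that], where ?'a = complex]
      by (simp add: G_def infsumI)
  qed
  ultimately show thesis
    using that by blast
qed

section \<open>A Fubini criterion for null sets\<close>

text \<open>
  Fubini's theorem applied to the dilations \<open>y \<mapsto> p + t (y - p)\<close>, \<open>1 \<le> t \<le> 2\<close>, which avoids polar
  coordinates: for some \<open>t\<close> the preimage of \<open>B\<close> is null, hence so is \<open>B\<close>.
\<close>

lemma null_sets_if_rays_countable:
  fixes p :: "'a::euclidean_space"
  assumes B[measurable]: "B \<in> sets borel"
    and rays: "\<And>v. countable {t. p + t *\<^sub>R v \<in> B}"
  shows "B \<in> null_sets lborel"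
proof -
  have "AE y in lborel. AE t in lborel. t \<in> {1..2} \<longrightarrow> p + t *\<^sub>R (y - p) \<notin> B"
  proof (rule AE_I2)
    fix y
    show "AE t in lborel. t \<in> {1..2} \<longrightarrow> p + t *\<^sub>R (y - p) \<notin> B"
      by (rule AE_I'[OF countable_imp_null_set_lborel[OF rays[of "y - p"]]]) auto
  qed
  moreover have "(AE t in lborel. AE y in lborel. t \<in> {1..2} \<longrightarrow> p + t *\<^sub>R (y - p) \<notin> B)
      \<longleftrightarrow> (AE y in lborel. AE t::real in lborel. t \<in> {1..2} \<longrightarrow> p + t *\<^sub>R (y - p) \<notin> B)"
  proof (rule lborel_pair.AE_commute)
    have [measurable]: "(\<lambda>z. p + fst z *\<^sub>R (snd z - p)) \<in> borel_measurable (lborel \<Otimes>\<^sub>M lborel)"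
      "(\<lambda>z :: real \<times> 'a. fst z) \<in> borel_measurable (lborel \<Otimes>\<^sub>M lborel)"
      by measurable
    show "{z \<in> space (lborel \<Otimes>\<^sub>M lborel). fst z \<in> {1..2} \<longrightarrow> p + fst z *\<^sub>R (snd z - p) \<notin> B}
        \<in> sets (lborel \<Otimes>\<^sub>M lborel)"
      by measurable
  qed
  ultimately have ae: "AE t::real in lborel. AE y in lborel. t \<in> {1..2} \<longrightarrow> p + t *\<^sub>R (y - p) \<notin> B"
    by simp
  \<comment> \<open>The interval \<open>{1..2}\<close> has positive measure, so a property of almost
    every \<open>t\<close> holds for some \<open>t\<close> in it. This \<open>t\<close> is nonzero,
    as the affine change of variables below needs.\<close>
  obtain t :: real where t: "t \<in> {1..2}" and null: "AE y in lborel. p + t *\<^sub>R (y - p) \<notin> B"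
  proof (rule ccontr)
    assume "\<not> thesis"
    then have *: "t \<notin> {1..2}" if "AE y in lborel. t \<in> {1..2} \<longrightarrow> p + t *\<^sub>R (y - p) \<notin> B" for t
      using that \<open>\<And>t. t \<in> {1..2} \<Longrightarrow> _ \<Longrightarrow> thesis\<close> by (cases "t \<in> {1..2}") simp_all
    have "AE t::real in lborel. t \<notin> {1..2}"
      using ae by (rule eventually_mono) (rule *)
    then show False
      by (subst (asm) AE_iff_measurable[of "{1..2}"]) auto
  qed
  have "emeasure lborel B = (\<integral>\<^sup>+ y. indicator B y \<partial>lborel)"
    by simp
  also have "\<dots> = (\<integral>\<^sup>+ y. indicator B y
      \<partial>density (distr lborel borel (\<lambda>y. (p - t *\<^sub>R p) + t *\<^sub>R y)) (\<lambda>_. ennreal (\<bar>t\<bar> ^ DIM('a))))"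
    using t by (subst lborel_affine[of t "p - t *\<^sub>R p"]) auto
  also have "\<dots> = (\<integral>\<^sup>+ y. ennreal (\<bar>t\<bar> ^ DIM('a)) * indicator B ((p - t *\<^sub>R p) + t *\<^sub>R y) \<partial>lborel)"
    using t by (simp add: nn_integral_density nn_integral_distr del: nn_integral_indicator)
  also have "\<dots> = (\<integral>\<^sup>+ y. 0 \<partial>(lborel :: 'a measure))"
    using null by (intro nn_integral_cong_AE) (auto simp: algebra_simps indicator_def elim!: eventually_mono)
  finally show ?thesis
    by (simp add: null_sets_def)
qed

section \<open>Closure properties of real analytic functions\<close>

text \<open>As \<open>U\<close> is open, the radius can be shrunk until the ball lies in
  \<open>U\<close>. Closure properties then only have to produce a radius and coefficients.\<close>

lemma real_analytic_on_iff:
  "f real_analytic_on U \<longleftrightarrow> open U \<and> (\<forall>x\<in>U. \<exists>r>0. \<exists>a. \<forall>y\<in>ball x r.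
     ((\<lambda>\<alpha>. a \<alpha> * (\<Prod>i\<in>UNIV. (y $ i - x $ i) ^ \<alpha> i)) has_sum f y) UNIV)"
  (is "_ \<longleftrightarrow> _ \<and> (\<forall>x\<in>U. \<exists>r>0. \<exists>a. ?series x r a)")
proof safe
  assume U: "open U" and *: "\<forall>x\<in>U. \<exists>r>0. \<exists>a. ?series x r a"
  have "\<exists>r>0. \<exists>a. ball x r \<subseteq> U \<and> ?series x r a" if x: "x \<in> U" for x
  proof -
    obtain r a where "r > 0" "?series x r a"
      using * x by blast
    moreover obtain e where "e > 0" "ball x e \<subseteq> U"
      using x U open_contains_ball by blast
    ultimately have "min r e > 0" "ball x (min r e) \<subseteq> U" "?series x (min r e) a"
      by auto
    then show ?thesis
      by blast
  qed
  then show "f real_analytic_on U"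
    using U unfolding real_analytic_on_def by blast
qed (auto 0 4 simp: real_analytic_on_def)

lemma real_analytic_on_subset:
  assumes "f real_analytic_on U" "open V" "V \<subseteq> U"
  shows "f real_analytic_on V"
  using assms unfolding real_analytic_on_iff by blast

lemma real_analytic_on_const_mult:
  assumes "f real_analytic_on U"
  shows "(\<lambda>x. c * f x) real_analytic_on U"
  unfolding real_analytic_on_iff
proof (intro conjI ballI)
  show "open U"
    using assms by (simp add: real_analytic_on_def)
  fix x assume "x \<in> U"
  then obtain r a where r: "r > 0" and series: "\<And>y. y \<in> ball x r \<Longrightarrow>
      ((\<lambda>\<alpha>. a \<alpha> * (\<Prod>i\<in>UNIV. (y $ i - x $ i) ^ \<alpha> i)) has_sum f y) UNIV"
    using assms unfolding real_analytic_on_iff by blast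
  have "((\<lambda>\<alpha>. c * a \<alpha> * (\<Prod>i\<in>UNIV. (y $ i - x $ i) ^ \<alpha> i)) has_sum c * f y) UNIV"
    if "y \<in> ball x r" for y
    using has_sum_cmult_right[OF series[OF that], of c] by (simp add: mult.assoc)
  then show "\<exists>r>0. \<exists>a. \<forall>y\<in>ball x r.
      ((\<lambda>\<alpha>. a \<alpha> * (\<Prod>i\<in>UNIV. (y $ i - x $ i) ^ \<alpha> i)) has_sum c * f y) UNIV"
    using r by (intro exI[of _ r] conjI exI[of _ "\<lambda>\<alpha>. c * a \<alpha>"]) auto
qed

lemma real_analytic_on_add:
  assumes "f real_analytic_on U" "g real_analytic_on U"
  shows "(\<lambda>x. f x + g x) real_analytic_on U"
  unfolding real_analytic_on_iff
proof (intro conjI ballI)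
  show "open U"
    using assms by (simp add: real_analytic_on_def)
  fix x assume "x \<in> U"
  then obtain r a where r: "r > 0" and f: "\<And>y. y \<in> ball x r \<Longrightarrow>
      ((\<lambda>\<alpha>. a \<alpha> * (\<Prod>i\<in>UNIV. (y $ i - x $ i) ^ \<alpha> i)) has_sum f y) UNIV"
    using assms(1) unfolding real_analytic_on_iff by blast
  obtain s b where s: "s > 0" and g: "\<And>y. y \<in> ball x s \<Longrightarrow>
      ((\<lambda>\<alpha>. b \<alpha> * (\<Prod>i\<in>UNIV. (y $ i - x $ i) ^ \<alpha> i)) has_sum g y) UNIV"
    using assms(2) \<open>x \<in> U\<close> unfolding real_analytic_on_iff by blast
  have "((\<lambda>\<alpha>. (a \<alpha> + b \<alpha>) * (\<Prod>i\<in>UNIV. (y $ i - x $ i) ^ \<alpha> i)) has_sum f y + g y) UNIV"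
    if "y \<in> ball x (min r s)" for y
    using has_sum_add[OF f g, of y y] that by (simp add: distrib_right)
  then show "\<exists>r>0. \<exists>a. \<forall>y\<in>ball x r.
      ((\<lambda>\<alpha>. a \<alpha> * (\<Prod>i\<in>UNIV. (y $ i - x $ i) ^ \<alpha> i)) has_sum f y + g y) UNIV"
    using r s by (intro exI[of _ "min r s"] conjI exI[of _ "\<lambda>\<alpha>. a \<alpha> + b \<alpha>"]) auto
qed

lemma real_analytic_on_zero:
  assumes "open U"
  shows "(\<lambda>x. 0) real_analytic_on U"
  unfolding real_analytic_on_iff
proof (intro conjI ballI)
  fix x :: "real ^ 'a" assume "x \<in> U"
  show "\<exists>r>0. \<exists>a. \<forall>y\<in>ball x r.
      ((\<lambda>\<alpha>. a \<alpha> * (\<Prod>i\<in>UNIV. (y $ i - x $ i) ^ \<alpha> i)) has_sum 0) UNIV"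
    by (intro exI[of _ 1] conjI exI[of _ "\<lambda>_. 0"]) auto
qed (fact assms)

lemma real_analytic_on_sum:
  assumes "open U" and "\<And>j. j \<in> J \<Longrightarrow> f j real_analytic_on U"
  shows "(\<lambda>x. \<Sum>j\<in>J. f j x) real_analytic_on U"
proof (cases "finite J")
  case True
  then show ?thesis
    using assms(2)
    by (induction J) (simp_all add: real_analytic_on_zero[OF assms(1)] real_analytic_on_add)
qed (simp add: real_analytic_on_zero[OF assms(1)])

section \<open>Zero sets of real analytic functions\<close>

text \<open>On each line through \<open>p\<close> the zeros of \<open>f\<close> are among the zeros
  of a holomorphic function on a connected open set that does not vanish at the parameter of
  \<open>p\<close>, so they are countable. Continuity makes the zero set Borel.\<close>

lemma null_sets_zeros_power_series:
  fixes x p :: "real ^ 'n"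
  assumes series: "\<And>y. y \<in> ball x r \<Longrightarrow>
      ((\<lambda>\<alpha>. a \<alpha> * (\<Prod>i\<in>UNIV. (y $ i - x $ i) ^ \<alpha> i)) has_sum f y) UNIV"
    and cont: "continuous_on (ball x r) f"
    and p: "p \<in> ball x r" "f p \<noteq> 0"
  shows "{y \<in> ball x r. f y = 0} \<in> null_sets lborel"
proof (rule null_sets_if_rays_countable)
  obtain T where "closed T" "{y \<in> ball x r. f y = 0} = ball x r \<inter> T"
    using continuous_closedin_preimage_constant[OF cont, of 0] by (auto simp: closedin_closed)
  then show "{y \<in> ball x r. f y = 0} \<in> sets borel"
    by (auto intro: borel_open borel_closed)
  fix v
  obtain D G where D: "open D" "convex D" and G: "G holomorphic_on D"
    and in_D: "\<And>t. p + t *\<^sub>R v \<in> ball x r \<Longrightarrow> of_real t \<in> D"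
    and G_eq: "\<And>t. p + t *\<^sub>R v \<in> ball x r \<Longrightarrow> G (of_real t) = complex_of_real (f (p + t *\<^sub>R v))"
    using multi_power_series_along_line[OF series, where p = p and v = v] by metis
  obtain K where "\<And>n :: nat. compact (K n)" "\<Union>(range K) = D"
    using open_Union_compact_subsets[OF D(1)] by metis
  then have "fsigma D"
    unfolding fsigma_Union_compact by (intro exI[of _ K]) auto
  have "countable {z \<in> D. G z = 0}"
  \<comment> \<open>The countability of zeros is available for nonconstant functions. A constant
    \<open>G\<close> has no zeros, since the parameter \<open>0\<close> corresponds to
    \<open>p\<close>.\<close>
  proof (cases "G constant_on D")
    case True
    moreover have "0 \<in> D" "G 0 \<noteq> 0"
      using in_D[of 0] G_eq[of 0] p by auto
    ultimately have "{z \<in> D. G z = 0} = {}"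
      by (auto simp: constant_on_def)
    then show ?thesis
      by (simp only: countable_empty)
  next
    case False
    then show ?thesis
      using D G \<open>fsigma D\<close> by (intro holomorphic_countable_zeros convex_connected)
  qed
  then have "countable (complex_of_real ` {t. p + t *\<^sub>R v \<in> {y \<in> ball x r. f y = 0}})"
    by (rule countable_subset[rotated]) (use in_D G_eq in auto)
  then show "countable {t. p + t *\<^sub>R v \<in> {y \<in> ball x r. f y = 0}}"
    by (rule countable_image_inj_on) (simp add: inj_on_def)
qed

text \<open>Each point of \<open>U\<close> has a ball that either lies in the zero set
  \<open>Z\<close> or meets it in a null set. This makes both \<open>interior Z\<close> and its
  complement in \<open>U\<close> open, so a component meeting \<open>interior Z\<close> would lie in
  \<open>Z\<close>. Hence the second alternative always holds, and countably many such balls cover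
  \<open>U\<close>.\<close>

lemma null_sets_zeros_real_analytic_on:
  assumes h: "h real_analytic_on U"
    and nonzero: "\<And>C. C \<in> components U \<Longrightarrow> \<exists>x\<in>C. h x \<noteq> 0"
  shows "{x \<in> U. h x = 0} \<in> null_sets lborel"
proof -
  define Z where "Z = {x \<in> U. h x = 0}"
  have "\<exists>r>0. ball x r \<subseteq> U \<and> (ball x r \<subseteq> Z \<or> Z \<inter> ball x r \<in> null_sets lborel)" if x: "x \<in> U" for x
  proof -
    obtain r a where r: "r > 0" "ball x r \<subseteq> U" and series: "\<And>y. y \<in> ball x r \<Longrightarrow>
        ((\<lambda>\<alpha>. a \<alpha> * (\<Prod>i\<in>UNIV. (y $ i - x $ i) ^ \<alpha> i)) has_sum h y) UNIV"
      using h x unfolding real_analytic_on_def by blast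
    have "Z \<inter> ball x r \<in> null_sets lborel" if not_sub: "\<not> ball x r \<subseteq> Z"
    proof -
      obtain p where "p \<in> ball x r" "h p \<noteq> 0"
        using not_sub r unfolding Z_def by blast
      moreover have "continuous_on (ball x r) h"
        using real_analytic_on_imp_continuous_on[OF h] r(2) by (rule continuous_on_subset)
      ultimately have "{y \<in> ball x r. h y = 0} \<in> null_sets lborel"
        using series by (intro null_sets_zeros_power_series)
      also have "{y \<in> ball x r. h y = 0} = Z \<inter> ball x r"
        using r by (auto simp: Z_def)
      finally show ?thesis .
    qed
    with r show ?thesis
      by blast
  qed
  then obtain r where r: "\<And>x. x \<in> U \<Longrightarrow> r x > 0 \<and> ball x (r x) \<subseteq> U"
    and dichotomy: "\<And>x. x \<in> U \<Longrightarrow> ball x (r x) \<subseteq> Z \<or> Z \<inter> ball x (r x) \<in> null_sets lborel"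
    by metis
  \<comment> \<open>The ball is not contained in \<open>Z\<close>, so it meets \<open>Z\<close> in a
    null set, which contains no nonempty open set.\<close>
  have isolated: "ball x (r x) \<inter> interior Z = {}" if "x \<in> U - interior Z" for x
  proof (rule ccontr)
    assume *: "ball x (r x) \<inter> interior Z \<noteq> {}"
    have "x \<in> ball x (r x)"
      using that r by simp
    then have "\<not> ball x (r x) \<subseteq> Z"
      using that interior_maximal[OF _ open_ball, of x "r x" Z] by blast
    then have "Z \<inter> ball x (r x) \<in> null_sets lborel"
      using dichotomy that by blast
    then have "negligible (Z \<inter> ball x (r x))"
      unfolding negligible_iff_null_sets by (rule null_sets_completionI)
    then have "negligible (ball x (r x) \<inter> interior Z)"
      by (rule negligible_subset) (use interior_subset in auto)
    then show False
      using * open_not_negligible by (metis open_Int open_ball open_interior)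
  qed
  have "open (U - interior Z)"
    unfolding open_contains_ball
  proof
    fix x assume x: "x \<in> U - interior Z"
    then show "\<exists>e>0. ball x e \<subseteq> U - interior Z"
      using isolated[OF x] r[of x] by (intro exI[of _ "r x"]) blast
  qed
  have "C \<inter> interior Z = {}" if C: "C \<in> components U" for C
  proof -
    have "C \<subseteq> interior Z \<union> (U - interior Z)"
      using in_components_subset[OF C] by auto
    with in_components_connected[OF C]
    have "interior Z \<inter> C = {} \<or> (U - interior Z) \<inter> C = {}"
      using connectedD[of C "interior Z" "U - interior Z"] \<open>open (U - interior Z)\<close> by auto
    moreover have "\<not> C \<subseteq> Z"
      using nonzero[OF C] by (auto simp: Z_def)
    ultimately show ?thesis
      using in_components_subset[OF C] interior_subset[of Z] by blast
  qed
  then have "interior Z = {}"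
    using interior_subset[of Z] Union_components[of U] unfolding Z_def by blast
  have null: "Z \<inter> ball x (r x) \<in> null_sets lborel" if "x \<in> U" for x
  proof -
    have "ball x (r x) \<noteq> {}"
      using r[OF that] by simp
    then have "\<not> ball x (r x) \<subseteq> Z"
      using interior_maximal[OF _ open_ball, of x "r x" Z] \<open>interior Z = {}\<close> by blast
    then show ?thesis
      using dichotomy[OF that] by blast
  qed
  obtain \<F> where \<F>: "\<F> \<subseteq> (\<lambda>x. ball x (r x)) ` U" "countable \<F>" "\<Union>\<F> = (\<Union>x\<in>U. ball x (r x))"
    using Lindelof[of "(\<lambda>x. ball x (r x)) ` U"] by auto
  have "Z \<subseteq> \<Union>\<F>"
    unfolding \<F>(3) using r by (force simp: Z_def)
  then have "Z = (\<Union>B\<in>\<F>. Z \<inter> B)"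
    by auto
  also have "\<dots> \<in> null_sets lborel"
    using \<F>(1,2) null by (intro null_sets_UN') auto
  finally show ?thesis
    by (simp add: Z_def)
qed

section \<open>Determinants of sampling matrices under product measures\<close>

text \<open>The cofactors along the last row do not involve that row, so one \<open>c\<close> serves
  all \<open>y\<close>; the last cofactor is the previous determinant.\<close>

lemma det_sampling_matrix_last_row:
  obtains c where "c (Suc k) = Determinant.det (sampling_matrix f x k)"
    "\<And>y. Determinant.det (sampling_matrix f (x(Suc k := y)) (Suc k)) = (\<Sum>j\<in>{1..Suc k}. c j * f j y)"
proof -
  define A where "A y = sampling_matrix f (x(Suc k := y)) (Suc k)" for y
  \<comment> \<open>Any last sample gives the same cofactors, so \<open>undefined\<close> serves;
    \<open>j - 1\<close> converts to matrix columns numbered from \<open>0\<close>.\<close>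
  define c where "c j = cofactor (A undefined) k (j - 1)" for j
  have carrier: "A y \<in> carrier_mat (Suc k) (Suc k)" for y
    by (simp add: A_def sampling_matrix_def)
  have "mat_delete (A undefined) k k = sampling_matrix f x k"
    by (rule eq_matI) (auto simp: mat_delete_def A_def sampling_matrix_def)
  then have 1: "c (Suc k) = Determinant.det (sampling_matrix f x k)"
    by (simp add: c_def cofactor_def)
  have c_Suc: "cofactor (A y) k j = c (Suc j)" if "j < Suc k" for y j
  proof -
    have "mat_delete (A y) k j = mat_delete (A undefined) k j"
      using that by (intro eq_matI) (auto simp: mat_delete_def A_def sampling_matrix_def)
    then show ?thesis
      by (simp add: c_def cofactor_def)
  qed
  have "Determinant.det (A y) = (\<Sum>j\<in>{1..Suc k}. c j * f j y)" for y
  proof -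
    have "Determinant.det (A y) = (\<Sum>j<Suc k. A y $$ (k, j) * cofactor (A y) k j)"
      by (rule laplace_expansion_row[OF carrier]) simp
    also have "\<dots> = (\<Sum>j<Suc k. c (Suc j) * f (Suc j) y)"
      by (intro sum.cong refl) (simp add: c_Suc, simp add: A_def sampling_matrix_def)
    also have "\<dots> = (\<Sum>j\<in>{1..Suc k}. c j * f j y)"
      by (simp only: sum.atLeast1_atMost_eq One_nat_def)
    finally show ?thesis .
  qed
  then show thesis
    unfolding A_def by (rule that[of c, OF 1])
qed

text \<open>By the Leibniz formula the determinant is a polynomial in the entries.\<close>

lemma borel_measurable_det_sampling_matrix:
  assumes g: "\<And>i j. i \<in> {1..k} \<Longrightarrow> j \<in> {1..k} \<Longrightarrow> g j \<in> borel_measurable (N i)"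
  shows "(\<lambda>x. Determinant.det (sampling_matrix g x k)) \<in> borel_measurable (PiM {1..k} N)"
proof -
  have "Determinant.det (sampling_matrix g x k) =
      (\<Sum>p | p permutes {0..<k}. signof p * (\<Prod>i = 0..<k. g (Suc (p i)) (x (Suc i))))" for x
  proof -
    have "sampling_matrix g x k \<in> carrier_mat k k"
      by (simp add: sampling_matrix_def)
    moreover have "sampling_matrix g x k $$ (i, p i) = g (Suc (p i)) (x (Suc i))"
      if "p permutes {0..<k}" "i \<in> {0..<k}" for p i
      using permutes_in_image[OF that(1), of i] that(2) by (simp add: sampling_matrix_def)
    ultimately show ?thesis
      by (simp add: det_def')
  qed
  moreover have "(\<lambda>x. g (Suc (p i)) (x (Suc i))) \<in> borel_measurable (PiM {1..k} N)"
    if "p permutes {0..<k}" "i \<in> {0..<k}" for p i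
    using permutes_in_image[OF that(1), of i] that(2)
    by (intro measurable_compose[OF measurable_component_singleton[of "Suc i" "{1..k}" N]] g) auto
  ultimately show ?thesis
    by (auto intro!: borel_measurable_sum borel_measurable_times borel_measurable_prod)
qed

text \<open>The induction is isolated from analysis: all that is asked of the functions, besides
  measurability, is \<open>step\<close>, whose coefficient \<open>c (Suc k)\<close> will be the
  determinant of the previous stage.\<close>

lemma AE_det_sampling_matrix_nonzero:
  fixes N :: "nat \<Rightarrow> 'a measure"
  assumes sigma_finite: "\<And>i. sigma_finite_measure (N i)"
    and g: "\<And>i j. j \<in> {1..m} \<Longrightarrow> g j \<in> borel_measurable (N i)"
    and step: "\<And>k c. k < m \<Longrightarrow> c (Suc k) \<noteq> 0 \<Longrightarrow>
      AE y in N (Suc k). (\<Sum>j\<in>{1..Suc k}. c j * g j y) \<noteq> 0"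
    and "k \<le> m"
  shows "AE x in PiM {1..k} N. Determinant.det (sampling_matrix g x k) \<noteq> 0"
  using \<open>k \<le> m\<close>
proof (induction k)
  case 0
  then show ?case
    by (simp add: sampling_matrix_def)
next
  case (Suc k)
  interpret product_sigma_finite N
    by (intro product_sigma_finite.intro sigma_finite)
  \<comment> \<open>As \<open>u\<close> is the indicator of the singular samples, the claim says
    that its integral vanishes, and this integral can be iterated with the last sample
    innermost.\<close>
  define u :: "(nat \<Rightarrow> 'a) \<Rightarrow> ennreal"
    where "u x = (if Determinant.det (sampling_matrix g x (Suc k)) = 0 then 1 else 0)" for x
  have [measurable]: "(\<lambda>x. Determinant.det (sampling_matrix g x (Suc k)))
      \<in> borel_measurable (PiM {1..Suc k} N)"
    using Suc.prems by (intro borel_measurable_det_sampling_matrix g) auto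
  have u: "u \<in> borel_measurable (PiM {1..Suc k} N)"
    unfolding u_def by measurable
  have insert: "{1..Suc k} = insert (Suc k) {1..k}"
    by auto
  have "AE x in PiM {1..k} N. Determinant.det (sampling_matrix g x k) \<noteq> 0"
    using Suc by simp
  then have "AE x in PiM {1..k} N. (\<integral>\<^sup>+ y. u (x(Suc k := y)) \<partial>N (Suc k)) = 0"
  proof (eventually_elim)
    case (elim x)
    obtain c where "c (Suc k) \<noteq> 0" and
      c: "\<And>y. Determinant.det (sampling_matrix g (x(Suc k := y)) (Suc k)) = (\<Sum>j\<in>{1..Suc k}. c j * g j y)"
      using det_sampling_matrix_last_row[of k g x] elim by metis
    then have "AE y in N (Suc k). (\<Sum>j\<in>{1..Suc k}. c j * g j y) \<noteq> 0"
      using Suc.prems by (intro step) auto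
    then have "AE y in N (Suc k). u (x(Suc k := y)) = 0"
      by eventually_elim (simp only: u_def c if_False)
    then have "(\<integral>\<^sup>+ y. u (x(Suc k := y)) \<partial>N (Suc k)) = (\<integral>\<^sup>+ y. 0 \<partial>N (Suc k))"
      by (rule nn_integral_cong_AE)
    then show ?case
      by simp
  qed
  then have "(\<integral>\<^sup>+ x. (\<integral>\<^sup>+ y. u (x(Suc k := y)) \<partial>N (Suc k)) \<partial>PiM {1..k} N) = (\<integral>\<^sup>+ x. 0 \<partial>PiM {1..k} N)"
    by (rule nn_integral_cong_AE)
  then have "integral\<^sup>N (PiM {1..Suc k} N) u = 0"
    using u unfolding insert by (subst product_nn_integral_insert) auto
  then have "AE x in PiM {1..Suc k} N. u x = 0"
    by (simp only: nn_integral_0_iff_AE[OF u])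
  then show ?case
    by eventually_elim (simp add: u_def split: if_splits)
qed

section \<open>Absolutely continuous laws and almost sure nonsingularity\<close>

text \<open>A law with a density with respect to Lebesgue measure is absolutely continuous.\<close>

lemma AE_distributed_notin_null_set:
  fixes X :: "'w \<Rightarrow> 'a::euclidean_space"
  assumes X: "distributed M (restrict_space lborel \<Omega>) X p"
    and "open \<Omega>" and B: "B \<in> null_sets lborel"
  shows "AE \<omega> in M. X \<omega> \<notin> B"
proof -
  have "AE x in lborel. x \<notin> B"
    using B by (rule AE_not_in)
  then have "AE x in restrict_space lborel \<Omega>. x \<notin> B"
    using \<open>open \<Omega>\<close> by (subst AE_restrict_space_iff) (auto elim!: eventually_mono)
  then have "AE x in distr M (restrict_space lborel \<Omega>) X. x \<notin> B"
    unfolding distributed_distr_eq_density[OF X]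
    using distributed_borel_measurable[OF X] by (subst AE_density) (auto elim!: eventually_mono)
  then show ?thesis
    by (rule AE_distrD[OF distributed_measurable[OF X]])
qed

theorem theorem0p1:
  fixes \<Omega> :: "(real ^ 'd) set"
    and f :: "nat \<Rightarrow> real ^ 'd \<Rightarrow> real"
    and I :: "nat \<Rightarrow> (real ^ 'd) set"
    and \<sigma> :: "real ^ 'd \<Rightarrow> real"
    and M :: "'w measure"
    and X :: "nat \<Rightarrow> 'w \<Rightarrow> real ^ 'd"
  assumes "open \<Omega>" and "connected \<Omega>"
    and "\<forall>j\<ge>1. I j \<subseteq> \<Omega> \<and> I j \<in> null_sets lebesgue \<and> f j real_analytic_on (\<Omega> - I j)"
    and "\<forall>m\<ge>1. \<forall>C\<in>components (\<Omega> - (\<Union>j\<in>{1..m}. I j)). lin_indep_family_on {1..} f C"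
    and "prob_space M"
    and "\<forall>x\<in>\<Omega>. 0 \<le> \<sigma> x"
    and "\<forall>i\<ge>1. distributed M (restrict_space lborel \<Omega>) (X i) (\<lambda>x. ennreal (\<sigma> x))"
    and "prob_space.indep_vars M (\<lambda>_. restrict_space borel \<Omega>) X {1..}"
  shows "\<forall>m\<ge>1. AE \<omega> in M. Determinant.det (sampling_matrix f (\<lambda>i. X i \<omega>) m) \<noteq> 0"
proof (intro allI impI)
  fix m :: nat assume "1 \<le> m"
  interpret prob_space M by fact
  define U where "U = \<Omega> - (\<Union>j\<in>{1..m}. I j)"
  have f: "I j \<in> null_sets lebesgue" "f j real_analytic_on (\<Omega> - I j)" if "j \<in> {1..m}" for j
    using assms(3) that by auto
  \<comment> \<open>Here \<open>1 \<le> m\<close> matters: an empty intersection would be the whole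
    space.\<close>
  have "U = (\<Inter>j\<in>{1..m}. \<Omega> - I j)"
    using \<open>1 \<le> m\<close> by (auto simp: U_def)
  moreover have "open (\<Inter>j\<in>{1..m}. \<Omega> - I j)"
    using f(2) by (intro open_INT) (auto simp: real_analytic_on_def)
  ultimately have "open U"
    by simp
  have f_U: "f j real_analytic_on U" if "j \<in> {1..m}" for j
    using f(2)[OF that] \<open>open U\<close> by (rule real_analytic_on_subset) (use that in \<open>auto simp: U_def\<close>)
  \<comment> \<open>The sets \<open>I j\<close> are null only for the completed measure, but
    \<open>\<Omega> - U\<close> is also Borel, hence null for \<open>lborel\<close>.\<close>
  have "(\<Union>j\<in>{1..m}. I j) \<in> null_sets lebesgue"
    using f(1) by (intro null_sets_UN') auto
  then have "\<Omega> - U \<in> null_sets lebesgue"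
    by (rule null_sets_completion_subset[rotated]) (auto simp: U_def)
  moreover have "\<Omega> - U \<in> sets lborel"
    using \<open>open U\<close> \<open>open \<Omega>\<close> by auto
  ultimately have null_U: "\<Omega> - U \<in> null_sets lborel"
    by (simp add: null_sets_completion_iff)

  \<comment> \<open>The hypotheses say nothing about \<open>X 0\<close>, which is therefore replaced.\<close>
  define X' where "X' i = X (max 1 i)" for i
  define N where "N i = distr M borel (X' i)" for i
  have X'_distributed: "distributed M (restrict_space lborel \<Omega>) (X' i) (\<lambda>x. ennreal (\<sigma> x))" for i
    using assms(7)[rule_format, of "max 1 i"] by (simp add: X'_def)
  have X_in: "X' i \<in> borel_measurable M" "X' i \<in> space M \<rightarrow> \<Omega>" for i
  proof -
    have "X' i \<in> measurable M (restrict_space lborel \<Omega>)"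
      using X'_distributed by (rule distributed_measurable)
    then show "X' i \<in> borel_measurable M" "X' i \<in> space M \<rightarrow> \<Omega>"
      by (auto simp: measurable_restrict_space2_iff)
  qed
  have AE_X: "AE \<omega> in M. X' i \<omega> \<notin> B" if "B \<in> null_sets lborel" for i B
    using X'_distributed \<open>open \<Omega>\<close> that by (rule AE_distributed_notin_null_set)
  have AE_U: "AE \<omega> in M. X' i \<omega> \<in> U" for i
    using AE_X[OF null_U, of i] AE_space by eventually_elim (use X_in(2) in auto)

  \<comment> \<open>Off \<open>U\<close> nothing is known about the measurability of
    \<open>f j\<close>. Cutting off to zero there gives a Borel function and changes the matrix only
    on a null event, as the samples lie in \<open>U\<close> almost surely.\<close>
  define g where "g j y = indicator U y *\<^sub>R f j y" for j y
  have g: "g j \<in> borel_measurable borel" if "j \<in> {1..m}" for j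
    unfolding g_def using \<open>open U\<close> real_analytic_on_imp_continuous_on[OF f_U[OF that]]
    by (intro borel_measurable_continuous_on_indicator) auto
  \<comment> \<open>Independence identifies the joint law with the product measure on which the
    induction runs.\<close>
  have distr_X: "distr M (PiM {1..m} (\<lambda>_. borel)) (\<lambda>\<omega>. \<lambda>i\<in>{1..m}. X' i \<omega>) = PiM {1..m} N"
  proof -
    have "indep_vars (\<lambda>_. restrict_space borel \<Omega>) X {1..m}"
      using assms(8) by (rule indep_vars_subset) auto
    then have "indep_vars (\<lambda>_. borel) (\<lambda>i \<omega>. X i \<omega>) {1..m}"
      by (rule indep_vars_compose2) (auto intro: measurable_restrict_space1)
    also have "?this \<longleftrightarrow> indep_vars (\<lambda>_. borel) X' {1..m}"
      by (intro indep_vars_cong) (auto simp: X'_def max_def)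
    finally show ?thesis
      unfolding N_def using \<open>1 \<le> m\<close> X_in(1) by (subst (asm) indep_vars_iff_distr_eq_PiM) auto
  qed
  have "AE x in PiM {1..m} N. Determinant.det (sampling_matrix g x m) \<noteq> 0"
  proof (rule AE_det_sampling_matrix_nonzero[OF _ _ _ order_refl])
    \<comment> \<open>This is required at every index, including \<open>0\<close>, hence the use of
      \<open>X'\<close> instead of \<open>X\<close>.\<close>
    show "sigma_finite_measure (N i)" for i
      unfolding N_def using X_in(1) by (intro prob_space_imp_sigma_finite prob_space_distr)
    show "g j \<in> borel_measurable (N i)" if "j \<in> {1..m}" for i j
      using g[OF that] by (simp add: N_def)
    fix k and c :: "nat \<Rightarrow> real"
    assume k: "k < m" and c: "c (Suc k) \<noteq> 0"
    define h where "h y = (\<Sum>j\<in>{1..Suc k}. c j * f j y)" for y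
    have "h real_analytic_on U"
      unfolding h_def using k
      by (intro real_analytic_on_sum real_analytic_on_const_mult f_U \<open>open U\<close>) auto
    moreover have "\<exists>x\<in>C. h x \<noteq> 0" if "C \<in> components U" for C
    proof (rule ccontr)
      assume "\<not> (\<exists>x\<in>C. h x \<noteq> 0)"
      then have zero: "\<forall>x\<in>C. (\<Sum>j\<in>{1..Suc k}. c j * f j x) = 0"
        unfolding h_def by blast
      have "lin_indep_family_on {1..} f C"
        using assms(4) \<open>1 \<le> m\<close> that unfolding U_def by blast
      then have "\<forall>j\<in>{1..Suc k}. c j = 0"
        unfolding lin_indep_family_on_def
        by (elim allE[of _ "{1..Suc k}"] allE[of _ c] impE) (intro conjI zero, auto)
      then show False
        using c by simp
    qed
    ultimately have null_h: "{y \<in> U. h y = 0} \<in> null_sets lborel"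
      by (rule null_sets_zeros_real_analytic_on)
    have "AE \<omega> in M. (\<Sum>j\<in>{1..Suc k}. c j * g j (X' (Suc k) \<omega>)) \<noteq> 0"
      using AE_X[OF null_h, of "Suc k"] AE_U[of "Suc k"]
      by eventually_elim (simp add: g_def h_def)
    moreover have "{y \<in> space borel. (\<Sum>j\<in>{1..Suc k}. c j * g j y) \<noteq> 0} \<in> sets borel"
    proof -
      have [measurable]: "(\<lambda>y. \<Sum>j\<in>{1..Suc k}. c j * g j y) \<in> borel_measurable borel"
        using k g by (intro borel_measurable_sum borel_measurable_times borel_measurable_const) auto
      show ?thesis
        by measurable
    qed
    ultimately show "AE y in N (Suc k). (\<Sum>j\<in>{1..Suc k}. c j * g j y) \<noteq> 0"
      unfolding N_def using X_in(1) by (subst AE_distr_iff) auto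
  qed
  then have "AE x in distr M (PiM {1..m} (\<lambda>_. borel)) (\<lambda>\<omega>. \<lambda>i\<in>{1..m}. X' i \<omega>).
      Determinant.det (sampling_matrix g x m) \<noteq> 0"
    by (simp only: distr_X)
  moreover have "(\<lambda>\<omega>. \<lambda>i\<in>{1..m}. X' i \<omega>) \<in> measurable M (PiM {1..m} (\<lambda>_. borel))"
    using X_in(1) by (intro measurable_restrict)
  ultimately have "AE \<omega> in M. Determinant.det (sampling_matrix g (\<lambda>i\<in>{1..m}. X' i \<omega>) m) \<noteq> 0"
    by (rule AE_distrD[rotated])
  moreover have "AE \<omega> in M. \<forall>i\<in>{1..m}. X' i \<omega> \<in> U"
    by (intro AE_finite_allI AE_U) auto
  ultimately show "AE \<omega> in M. Determinant.det (sampling_matrix f (\<lambda>i. X i \<omega>) m) \<noteq> 0"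
  proof eventually_elim
    case (elim \<omega>)
    have "sampling_matrix f (\<lambda>i. X i \<omega>) m = sampling_matrix g (\<lambda>i\<in>{1..m}. X' i \<omega>) m"
      using elim(2) by (intro eq_matI) (auto simp: sampling_matrix_def g_def X'_def)
    with elim(1) show ?case
      by simp
  qed
qed

end
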